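(* Let $\mathcal{X}$ be a non-empty finite directed graph without loops (i.e. without closed directed paths), let $f:\mathcal{Y}\to\mathbb{R}$ be a boundary condition for $\mathcal{X}$, let $\hat f:\mathcal{X}\to\mathbb{R}$ be the unique extension of $f$ that is min-max averaging on $\mathcal{X}\setminus\mathcal{Y}$ inside $\mathcal{X}$, and let $d:\mathcal{X}\to\mathbb{R}$ be an arbitrary function. Set $$\delta:=\min_{x\in\mathcal{X}\setminus\mathcal{Y}}\ \min\mathcal{A}_x,\qquad \mathcal{A}_x:=\big\{|\hat f(u)-\hat f(v)|:\ u,v\in\mathcal{X}\text{ with }(u\lhd x\text{ and }v\lhd x)\text{ or }(x\lhd u\text{ and }x\lhd v)\big\}\setminus\{0\},$$ where $\min\emptyset:=\infty$. Suppose $g:\mathcal{X}\to\mathbb{R}$ satisfies $$g(y)=f(y)+d(y)\ \text{ for all }y\in\mathcal{Y},\qquad g(x)=\frac12\Big(\min_{y\in\mathcal{X}:\,x\lhd y}g(y)+\max_{y\in\mathcal{X}:\,y\lhd x}g(y)\Big)+d(x)\ \text{ for all }x\in\mathcal{X}\setminus\mathcal{Y},$$ and $\|g-\hat f\|_\infty=\max_{x\in\mathcal{X}}|g(x)-\hat f(x)|<\frac12\delta$. Then $$\|g-\hat f\|_\infty\le 2^{\ell}\,\|d\|_\infty,$$ where $\ell$ is the length of the longest path in $\mathcal{X}$.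
   Context: Let $(\mathcal{X},E_{\mathcal{X}})$ be a finite directed graph with edge set $E_{\mathcal X}\subset\mathcal{X}^2$; write $x\lhd y$ if $(x,y)\in E_{\mathcal X}$. A path of length $n$ from $x$ to $y$ is a sequence $x=\gamma_0\lhd\gamma_1\lhd\dots\lhd\gamma_n=y$, $n\ge 1$ (if there are no edges, the longest path is understood to have length $0$). The graph has no loops if there is no path from any $x$ to itself. The future $\mathcal{F}^{\mathcal X}_x$ of $x$ is the set of $y$ such that there is a path from $x$ to $y$; the past of $x$ is the set of $y$ such that there is a path from $y$ to $x$. A function $g:\mathcal{X}\to\mathbb{R}$ is increasing on $\mathcal{X}$ if $g(x)\le g(y)$ whenever $x\lhd y$. For $\mathcal{Z}\subset\mathcal{X}$, $g$ is min-max averaging on $\mathcal{Z}$ inside $\mathcal{X}$ if $g$ is increasing on $\mathcal{X}$ and $$g(y)=\frac12\Big(\min_{x\in\mathcal{X}:\,y\lhd x}g(x)+\max_{x\in\mathcal{X}:\,x\lhd y}g(x)\Big)\qquad\text{for all }y\in\mathcal{Z}.$$ A function $f:\mathcal{Y}\to\mathbb{R}$ on a subgraph $(\mathcal{Y},E_{\mathcal Y})$ is a boundary condition for $\mathcal{X}$ if: $f$ is increasing on $\mathcal{Y}$; $\mathcal{Y}$ contains all $x\in\mathcal{X}$ with empty past or empty future in $\mathcal{X}$; $E_{\mathcal Y}=E_{\mathcal X}\cap\mathcal{Y}^2$; and $f(x)\le f(y)$ for all $x,y\in\mathcal{Y}$ with $y\in\mathcal{F}^{\mathcal X}_x$. For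 every boundary condition $f$ there is a unique extension $\hat f:\mathcal{X}\to\mathbb{R}$ of $f$ that is min-max averaging on $\mathcal{X}\setminus\mathcal{Y}$ inside $\mathcal{X}$. *)

theory Defs
  imports "Graph_Theory.Pair_Digraph" "Graph_Theory.Digraph_Component" "HOL-Library.Extended_Real"
begin

text \<open>
  A directed graph with vertex set \<open>X\<close> and edge set \<open>E \<subseteq> X \<times> X\<close> is a \<open>pair_pre_digraph\<close>
  satisfying \<open>pair_wf_digraph\<close>; the relation \<open>x \<lhd> y\<close> is \<open>(x, y) \<in> parcs G\<close>.
  Real functions on the vertices are total functions on the vertex type; only their values on the
  vertices of the graph in question are ever used.
\<close>

text \<open>Library walks may be empty; paths here have length at least one.\<close>

definition dipath :: "'a pair_pre_digraph \<Rightarrow> 'a \<Rightarrow> ('a \<times> 'a) list \<Rightarrow> 'a \<Rightarrow> bool" where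
  "dipath G x p y \<longleftrightarrow> pre_digraph.awalk (with_proj G) x p y \<and> length p \<ge> 1"

definition without_loops :: "'a pair_pre_digraph \<Rightarrow> bool" where
  "without_loops G \<longleftrightarrow> (\<forall>x\<in>pverts G. \<not> (\<exists>p. dipath G x p x))"

definition future :: "'a pair_pre_digraph \<Rightarrow> 'a \<Rightarrow> 'a set" where
  "future G x = {y. \<exists>p. dipath G x p y}"

definition past :: "'a pair_pre_digraph \<Rightarrow> 'a \<Rightarrow> 'a set" where
  "past G x = {y. \<exists>p. dipath G y p x}"

text \<open>Inserting \<open>0\<close> covers graphs without edges.\<close>

definition longest_path_length :: "'a pair_pre_digraph \<Rightarrow> nat" where
  "longest_path_length G = Max (insert 0 {length p | x p y. dipath G x p y})"

definition increasing_on :: "'a pair_pre_digraph \<Rightarrow> ('a \<Rightarrow> real) \<Rightarrow> bool" where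
  "increasing_on G g \<longleftrightarrow> (\<forall>(x, y)\<in>parcs G. g x \<le> g y)"

text \<open>
  \<open>Min\<close> and \<open>Max\<close> are unspecified on the empty set, so the following is meaningful only at vertices
  that have both a successor and a predecessor. A boundary condition contains all other vertices.
\<close>

definition min_max_mean :: "'a pair_pre_digraph \<Rightarrow> ('a \<Rightarrow> real) \<Rightarrow> 'a \<Rightarrow> real" where
  "min_max_mean G g x =
     1/2 * (Min (g ` {y \<in> pverts G. (x, y) \<in> parcs G}) + Max (g ` {y \<in> pverts G. (y, x) \<in> parcs G}))"

definition min_max_averaging :: "'a set \<Rightarrow> 'a pair_pre_digraph \<Rightarrow> ('a \<Rightarrow> real) \<Rightarrow> bool" where
  "min_max_averaging Z G g \<longleftrightarrow>
     Z \<subseteq> pverts G \<and> increasing_on G g \<and> (\<forall>y\<in>Z. g y = min_max_mean G g y)"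

text \<open>
  \<open>f\<close> is a function on the subgraph \<open>H\<close> of \<open>G\<close>. The library's \<open>induced_subgraph\<close> says that the
  edges of \<open>H\<close> are exactly the edges of \<open>G\<close> between vertices of \<open>H\<close>.
\<close>

definition boundary_condition ::
  "'a pair_pre_digraph \<Rightarrow> 'a pair_pre_digraph \<Rightarrow> ('a \<Rightarrow> real) \<Rightarrow> bool" where
  "boundary_condition G H f \<longleftrightarrow>
     induced_subgraph (with_proj H) (with_proj G) \<and>
     increasing_on H f \<and>
     {x \<in> pverts G. past G x = {} \<or> future G x = {}} \<subseteq> pverts H \<and>
     (\<forall>x\<in>pverts H. \<forall>y\<in>pverts H. y \<in> future G x \<longrightarrow> f x \<le> f y)"

definition min_max_extension ::
  "'a pair_pre_digraph \<Rightarrow> 'a pair_pre_digraph \<Rightarrow> ('a \<Rightarrow> real) \<Rightarrow> ('a \<Rightarrow> real) \<Rightarrow> bool" where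
  "min_max_extension G H f fhat \<longleftrightarrow>
     (\<forall>y\<in>pverts H. fhat y = f y) \<and> min_max_averaging (pverts G - pverts H) G fhat"

definition gap_set :: "'a pair_pre_digraph \<Rightarrow> ('a \<Rightarrow> real) \<Rightarrow> 'a \<Rightarrow> real set" where
  "gap_set G h x =
     {\<bar>h u - h v\<bar> | u v. u \<in> pverts G \<and> v \<in> pverts G \<and>
        ((u, x) \<in> parcs G \<and> (v, x) \<in> parcs G \<or> (x, u) \<in> parcs G \<and> (x, v) \<in> parcs G)} - {0}"

text \<open>
  All index sets are finite, so the infima in \<open>ereal\<close> are minima, with value \<open>\<infinity>\<close> on the empty set.
\<close>

definition min_gap :: "'a pair_pre_digraph \<Rightarrow> 'a pair_pre_digraph \<Rightarrow> ('a \<Rightarrow> real) \<Rightarrow> ereal" where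
  "min_gap G H h = (INF x\<in>pverts G - pverts H. INF a\<in>gap_set G h x. ereal a)"

definition max_norm :: "'a pair_pre_digraph \<Rightarrow> ('a \<Rightarrow> real) \<Rightarrow> real" where
  "max_norm G h = Max ((\<lambda>x. \<bar>h x\<bar>) ` pverts G)"

end

theory Submission
  imports Defs
begin

text \<open>
  Put \<open>h = g - fhat\<close>, \<open>D = \<parallel>d\<parallel>\<close> and let \<open>M\<close> be the maximum of \<open>h\<close>. At an interior vertex \<open>x\<close>,
  bounding the minimum at a successor \<open>u\<close> and the maximum by \<open>M\<close> gives
  \<open>h x \<le> (h u + M) / 2 + D\<close>, so the deficit \<open>M - h\<close> at \<open>u\<close> is at most \<open>2 (M - h x) + 2 D\<close>.
  Starting at a maximiser of \<open>h\<close>, where the deficit is \<open>0\<close>, and moving upwards, the boundary is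
  reached with deficit at least \<open>M - D\<close>. A maximiser in the interior has a predecessor, so at most
  \<open>\<ell> - 1\<close> steps are made, whence \<open>M \<le> (2 ^ \<ell> - 1) D\<close>. The minimum of \<open>h\<close> is treated in the same
  way, moving downwards.
\<close>

text \<open>A minimiser \<open>u\<close> of \<open>b\<close> works, since the minimum of
  \<open>a\<close> is at most \<open>a u\<close>.\<close>

lemma ex_Min_image_diff_le:
  fixes a b :: "'b \<Rightarrow> real"
  assumes "finite S" "S \<noteq> {}"
  shows "\<exists>u\<in>S. Min (a ` S) - Min (b ` S) \<le> a u - b u"
proof -
  obtain u where "u \<in> S" "Min (b ` S) = b u"
    using Min_in[of "b ` S"] assms by fastforce
  then show ?thesis using assms by (intro bexI[of _ u]) auto
qed

text \<open>Here a maximiser \<open>u\<close> of \<open>a\<close> works, since the maximum of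
  \<open>b\<close> is at least \<open>b u\<close>.\<close>

lemma ex_Max_image_diff_le:
  fixes a b :: "'b \<Rightarrow> real"
  assumes "finite S" "S \<noteq> {}"
  shows "\<exists>u\<in>S. Max (a ` S) - Max (b ` S) \<le> a u - b u"
proof -
  obtain u where "u \<in> S" "Max (a ` S) = a u"
    using Max_in[of "a ` S"] assms by fastforce
  then show ?thesis using assms by (intro bexI[of _ u]) auto
qed

text \<open>This transfers the bound on path lengths to the reversed edges.\<close>

lemma relpow_converse:
  fixes R :: "('a \<times> 'a) set"
  shows "(R\<inverse>) ^^ n = (R ^^ n)\<inverse>"
proof (induction n)
  case (Suc n)
  then have "(R\<inverse>) ^^ Suc n = (R O R ^^ n)\<inverse>" by (simp add: converse_relcomp)
  then show ?case by (simp only: relpow_commute relpow.simps)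
qed simp

text \<open>The relation is kept abstract because the argument serves twice: for \<open>h\<close>
  along the edges and for \<open>- h\<close> along the reversed edges.\<close>

lemma le_pow_of_doubling_deficit:
  fixes h :: "'a \<Rightarrow> real"
  assumes len: "\<And>k x y. (x, y) \<in> R ^^ k \<Longrightarrow> k \<le> L"
    and bdry: "\<And>x. x \<in> V \<Longrightarrow> x \<in> Y \<Longrightarrow> h x \<le> D"
    and step: "\<And>x. x \<in> V \<Longrightarrow> x \<notin> Y \<Longrightarrow> \<exists>u\<in>V. (x, u) \<in> R \<and> M - h u \<le> 2 * (M - h x) + 2 * D"
    and start: "x \<in> V" "h x = M"
    and pred: "x \<notin> Y \<Longrightarrow> \<exists>w. (w, x) \<in> R"
    and D: "0 \<le> D"
  shows "M \<le> 2 ^ L * D"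
proof (cases "x \<in> Y")
  case True
  have "1 * D \<le> 2 ^ L * D" using D by (intro mult_right_mono) auto
  then show ?thesis using bdry[OF start(1) True] start(2) by simp
next
  case False
  then obtain w where w: "(w, x) \<in> R" using pred by blast
  \<comment> \<open>The factor \<open>2 ^ k - 2\<close> solves the recursion
    \<open>e (k + 1) = 2 * e k + 2\<close> with \<open>e 1 = 0\<close>. Walks are counted from
    \<open>w\<close>, one step before \<open>x\<close>, so the deficit \<open>0\<close> at
    \<open>x\<close> belongs to \<open>k = 1\<close>; counting from \<open>x\<close> itself would
    cost a further factor of about \<open>2\<close>.\<close>
  have main: "M \<le> (2 ^ L - 1) * D"
    if "(w, z) \<in> R ^^ k" "z \<in> V" "M - h z \<le> (2 ^ k - 2) * D" for k z
    using that
  proof (induction "L - k" arbitrary: k z rule: less_induct)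
    case less
    have kL: "k \<le> L" using len less.prems(1) .
    show ?case
    proof (cases "z \<in> Y")
      case True
      \<comment> \<open>On the boundary, \<open>h z \<le> D\<close> turns the deficit bound into
        \<open>M \<le> (2 ^ k - 1) * D\<close>.\<close>
      have "(2::real) ^ k \<le> 2 ^ L" using kL by simp
      then have "2 ^ k * D \<le> 2 ^ L * D" using D by (intro mult_right_mono) auto
      then show ?thesis using bdry[OF less.prems(2) True] less.prems(3)
        by (simp add: algebra_simps)
    next
      case False
      obtain u where u: "u \<in> V" "(z, u) \<in> R" "M - h u \<le> 2 * (M - h z) + 2 * D"
        using step[OF less.prems(2) False] by blast
      have wu: "(w, u) \<in> R ^^ Suc k" using less.prems(1) u(2) by auto
      \<comment> \<open>The walk prolonged to \<open>u\<close> still has length at most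
        \<open>L\<close>, so \<open>k < L\<close> and the truncated difference really drops.\<close>
      have "L - Suc k < L - k" using len[OF wu] by simp
      moreover have "M - h u \<le> (2 ^ Suc k - 2) * D"
        using u(3) less.prems(3) by (simp add: algebra_simps)
      ultimately show ?thesis using less.hyps wu u(1) by blast
    qed
  qed
  have "(w, x) \<in> R ^^ 1" using w by simp
  then have "M \<le> (2 ^ L - 1) * D" using main[of x 1] start by simp
  then show ?thesis using D by (simp add: algebra_simps)
qed

lemma (in pair_fin_digraph) relpow_parcs_imp_awalk:
  assumes "(x, y) \<in> parcs G ^^ k" "x \<in> pverts G"
  shows "\<exists>p. awalk x p y \<and> length p = k"
  using assms
proof (induction k arbitrary: y)
  case 0
  then show ?case by (auto simp: awalk_Nil_iff)
next
  case (Suc k)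
  then obtain z where "(x, z) \<in> parcs G ^^ k" "(z, y) \<in> parcs G" by auto
  moreover from this Suc obtain p where "awalk x p z" "length p = k" by blast
  ultimately have "awalk x p z" "length p = k" "(z, y) \<in> parcs G" by simp_all
  then have "awalk x (p @ [(z, y)]) y"
    by (intro awalk_appendI) (auto simp: awalk_simps in_arcsD2)
  then show ?case using \<open>length p = k\<close> by (intro exI[of _ "p @ [(z, y)]"]) simp
qed

text \<open>The set under \<open>Max\<close> is finite: a repeated vertex on a path would split off
  a closed path, so all paths have distinct vertices, and a finite graph has only finitely many of
  these.\<close>

lemma (in pair_fin_digraph) length_dipath_le_longest:
  assumes "without_loops G" "dipath G x p y"
  shows "length p \<le> longest_path_length G"
proof -
  have "apath u q v" if "dipath G u q v" for u q v
  proof -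
    have w: "awalk u q v" using that by (simp add: dipath_def)
    have "distinct (awalk_verts u q)"
    proof (rule ccontr)
      assume "\<not> distinct (awalk_verts u q)"
      then obtain r z where "awalk z r z" "length r \<ge> 1"
        using awalk_not_distinct_decomp[OF w] by (metis Suc_leI One_nat_def)
      then show False
        using assms(1) awalk_hd_in_verts unfolding without_loops_def dipath_def by blast
    qed
    then show ?thesis using w by (simp add: apath_def)
  qed
  then have "{length q | u q v. dipath G u q v} \<subseteq> (\<lambda>(u, q, v). length q) ` {(u, q, v). apath u q v}"
    by force
  then have "finite {length q | u q v. dipath G u q v}"
    using apaths_finite_triple finite_surj by blast
  then show ?thesis
    unfolding longest_path_length_def using assms(2) by (intro Max_ge) auto
qed

lemma (in pair_fin_digraph) relpow_parcs_le_longest: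
  assumes "without_loops G" "(x, y) \<in> parcs G ^^ k"
  shows "k \<le> longest_path_length G"
proof (cases k)
  \<comment> \<open>The power \<open>0\<close> also relates elements outside the graph to
    themselves; for positive powers the first edge shows that \<open>x\<close> is a vertex.\<close>
  case (Suc j)
  obtain z where "(x, z) \<in> parcs G" using relpow_Suc_D2[OF assms(2)[unfolded Suc]] by blast
  then have "x \<in> pverts G" by (rule in_arcsD1)
  then obtain p where "awalk x p y" "length p = k"
    using relpow_parcs_imp_awalk assms(2) by blast
  then show ?thesis
    using length_dipath_le_longest[OF assms(1), of x p y] Suc by (simp add: dipath_def)
qed simp

lemma (in pair_fin_digraph) future_nonempty_imp_succ:
  assumes "future G x \<noteq> {}"
  shows "\<exists>y. (x, y) \<in> parcs G"
proof -
  obtain p y where "awalk x p y" "p \<noteq> []" using assms by (force simp: future_def dipath_def)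
  then show ?thesis by (cases p) (auto simp: awalk_Cons_iff)
qed

lemma (in pair_fin_digraph) past_nonempty_imp_pred:
  assumes "past G x \<noteq> {}"
  shows "\<exists>y. (y, x) \<in> parcs G"
proof -
  obtain p y where "awalk y p x" "p \<noteq> []" using assms by (force simp: past_def dipath_def)
  then show ?thesis by (cases p rule: rev_cases) (auto simp: awalk_Cons_iff awalk_Nil_iff)
qed

theorem lemma5p5:
  fixes G H :: "'a pair_pre_digraph"
    and f fhat d g :: "'a \<Rightarrow> real"
  assumes "pair_fin_digraph G"
    and "pverts G \<noteq> {}"
    and "without_loops G"
    and "boundary_condition G H f"
    and "min_max_extension G H f fhat"
    and "\<And>y. y \<in> pverts H \<Longrightarrow> g y = f y + d y"
    and "\<And>x. x \<in> pverts G - pverts H \<Longrightarrow> g x = min_max_mean G g x + d x"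
    and "ereal (max_norm G (\<lambda>x. g x - fhat x)) < min_gap G H fhat / 2"
  shows "max_norm G (\<lambda>x. g x - fhat x) \<le> 2 ^ longest_path_length G * max_norm G d"
proof -
  interpret pair_fin_digraph G by fact
  define V where "V = pverts G"
  define Y where "Y = pverts H"
  define R where "R = parcs G"
  define h where "h = (\<lambda>x. g x - fhat x)"
  define D where "D = max_norm G d"
  define L where "L = longest_path_length G"
  define succs where "succs = (\<lambda>x. {y \<in> pverts G. (x, y) \<in> parcs G})"
  define preds where "preds = (\<lambda>x. {y \<in> pverts G. (y, x) \<in> parcs G})"
  note defs = V_def Y_def R_def succs_def preds_def
  have finV: "finite V" and neV: "V \<noteq> {}" using pair_finite_verts assms(2) by (auto simp: V_def)
  have d_le: "\<bar>d x\<bar> \<le> D" if "x \<in> V" for x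
    using that finV unfolding D_def max_norm_def V_def by (intro Max_ge) auto
  have D0: "0 \<le> D" using neV d_le by (meson abs_ge_zero all_not_in_conv order_trans)
  have len: "k \<le> L" if "(x, y) \<in> R ^^ k" for k x y
    using relpow_parcs_le_longest[OF assms(3)] that by (simp add: R_def L_def)
  have bd: "h x = d x" if "x \<in> Y" for x
    using that assms(5,6) by (simp add: h_def Y_def min_max_extension_def)
  \<comment> \<open>Vertices with empty past or future lie in \<open>Y\<close>, so every
    \<open>Min\<close> and \<open>Max\<close> taken at an interior vertex is over a nonempty
    set.\<close>
  have nbrs: "\<exists>y. (x, y) \<in> R" "\<exists>y. (y, x) \<in> R" if "x \<in> V" "x \<notin> Y" for x
    using that assms(4) future_nonempty_imp_succ past_nonempty_imp_pred
    unfolding boundary_condition_def defs by blast+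
  have fin: "finite (succs x)" "finite (preds x)" for x
    using pair_finite_verts by (auto simp: succs_def preds_def)
  have ne: "succs x \<noteq> {}" "preds x \<noteq> {}" if "x \<in> V" "x \<notin> Y" for x
    using nbrs[OF that] unfolding defs by (blast dest: in_arcsD1 in_arcsD2)+
  \<comment> \<open>Subtract the averaging equation of \<open>fhat\<close> from the perturbed one of
    \<open>g\<close>.\<close>
  have h_eq: "h x = 1/2 * ((Min (g ` succs x) - Min (fhat ` succs x))
      + (Max (g ` preds x) - Max (fhat ` preds x))) + d x" if "x \<in> V" "x \<notin> Y" for x
  proof -
    have "g x = min_max_mean G g x + d x" using assms(7) that by (simp add: V_def Y_def)
    moreover have "fhat x = min_max_mean G fhat x"
      using assms(5) that by (simp add: min_max_extension_def min_max_averaging_def V_def Y_def)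
    ultimately show ?thesis
      by (simp add: h_def min_max_mean_def succs_def preds_def algebra_simps)
  qed
  have upper: "h x \<le> 2 ^ L * D" if x: "x \<in> V" for x
  proof -
    define M where "M = Max (h ` V)"
    have M_ge: "h z \<le> M" if "z \<in> V" for z using that finV by (simp add: M_def)
    obtain x0 where x0: "x0 \<in> V" "h x0 = M"
      using Max_in[of "h ` V"] finV neV unfolding M_def by fastforce
    have "M \<le> 2 ^ L * D"
    proof (rule le_pow_of_doubling_deficit[where R = R and V = V and Y = Y and h = h and x = x0])
      fix z assume z: "z \<in> V" "z \<notin> Y"
      obtain u where u: "u \<in> succs z" "Min (g ` succs z) - Min (fhat ` succs z) \<le> h u"
        using ex_Min_image_diff_le[OF fin(1) ne(1)[OF z], of g fhat] by (auto simp: h_def)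
      obtain v where v: "v \<in> preds z" "Max (g ` preds z) - Max (fhat ` preds z) \<le> h v"
        using ex_Max_image_diff_le[OF fin(2) ne(2)[OF z], of g fhat] by (auto simp: h_def)
      \<comment> \<open>Only the predecessor term is estimated by \<open>M\<close>; the successor
        \<open>u\<close> carries the deficit onwards.\<close>
      have "h v \<le> M" using v(1) M_ge by (simp add: preds_def V_def)
      then have "M - h u \<le> 2 * (M - h z) + 2 * D"
        using h_eq[OF z] u(2) v(2) d_le[OF z(1)] by argo
      then show "\<exists>u\<in>V. (z, u) \<in> R \<and> M - h u \<le> 2 * (M - h z) + 2 * D"
        using u(1) by (auto simp: defs)
    next
      show "h z \<le> D" if "z \<in> V" "z \<in> Y" for z using bd[OF that(2)] d_le[OF that(1)] by simp
    qed (use len x0 nbrs D0 in auto)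
    then show ?thesis using M_ge[OF x] by simp
  qed
  have lower: "- h x \<le> 2 ^ L * D" if x: "x \<in> V" for x
  proof -
    define M where "M = Max ((\<lambda>x. - h x) ` V)"
    have M_ge: "- h z \<le> M" if "z \<in> V" for z using that finV by (simp add: M_def)
    obtain x0 where x0: "x0 \<in> V" "- h x0 = M"
      using Max_in[of "(\<lambda>x. - h x) ` V"] finV neV unfolding M_def by fastforce
    have "M \<le> 2 ^ L * D"
    proof (rule le_pow_of_doubling_deficit[where R = "R\<inverse>" and V = V and Y = Y
          and h = "\<lambda>x. - h x" and x = x0])
      fix z assume z: "z \<in> V" "z \<notin> Y"
      obtain u where u: "u \<in> succs z" "Min (fhat ` succs z) - Min (g ` succs z) \<le> - h u"
        using ex_Min_image_diff_le[OF fin(1) ne(1)[OF z], of fhat g] by (auto simp: h_def)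
      obtain v where v: "v \<in> preds z" "Max (fhat ` preds z) - Max (g ` preds z) \<le> - h v"
        using ex_Max_image_diff_le[OF fin(2) ne(2)[OF z], of fhat g] by (auto simp: h_def)
      \<comment> \<open>For \<open>- h\<close> the roles are exchanged: the successor term is
        estimated by \<open>M\<close>, and the predecessor \<open>v\<close> continues the
        walk.\<close>
      have "- h u \<le> M" using u(1) M_ge by (simp add: succs_def V_def)
      then have "M - - h v \<le> 2 * (M - - h z) + 2 * D"
        using h_eq[OF z] u(2) v(2) d_le[OF z(1)] by argo
      then show "\<exists>u\<in>V. (z, u) \<in> R\<inverse> \<and> M - - h u \<le> 2 * (M - - h z) + 2 * D"
        using v(1) by (auto simp: defs)
    next
      show "- h z \<le> D" if "z \<in> V" "z \<in> Y" for z using bd[OF that(2)] d_le[OF that(1)] by simp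
    qed (use len x0 nbrs D0 in \<open>auto simp: relpow_converse\<close>)
    then show ?thesis using M_ge[OF x] by simp
  qed
  have "max_norm G h \<le> 2 ^ L * D"
    unfolding max_norm_def using finV neV upper lower
    by (intro Max.boundedI) (auto simp: V_def abs_le_iff)
  then show ?thesis by (simp add: h_def D_def L_def)
qed

end
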